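(* Fix an integer $d \geq 3$. Then, as $n \to \infty$, $$(1 - o_n(1))\, \frac{1}{4ed^4} \;\leq\; \frac{H_{pm}(n, d)\, d!}{n^{d-1}} \;\leq\; \frac{6}{d+1}.$$
   Context: For a pure simplicial complex $C$, its facets are its top-dimensional faces and its ridges are its faces of codimension one. The dual graph $G(C)$ has the facets of $C$ as vertices, two facets being adjacent if they intersect in a ridge. $C$ is strongly connected if $G(C)$ is connected, and the combinatorial diameter of $C$ is the graph diameter of $G(C)$. A (d-1)-dimensional pseudomanifold (without boundary) is a pure $(d-1)$-dimensional simplicial complex in which every ridge is contained in exactly two facets. $H_{pm}(n,d)$ denotes the largest combinatorial diameter of a strongly connected $(d-1)$-dimensional pseudomanifold on $n$ vertices. Here $e$ is Euler's number and $o_n(1)$ denotes a quantity tending to $0$ as $n\to\infty$ (with $d$ fixed). *)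

theory Defs
  imports Complex_Main
begin

definition abstract_complex :: "'a set set \<Rightarrow> bool" where
  "abstract_complex K \<longleftrightarrow>
     finite K \<and> K \<noteq> {} \<and> (\<forall>\<sigma>\<in>K. finite \<sigma>) \<and> (\<forall>\<sigma>\<in>K. \<forall>\<tau>. \<tau> \<subseteq> \<sigma> \<longrightarrow> \<tau> \<in> K)"

text \<open>The empty set is a face of every complex; integer-valued dimensions give it dimension \<open>-1\<close>.\<close>

definition face_dim :: "'a set \<Rightarrow> int" where
  "face_dim \<sigma> = int (card \<sigma>) - 1"

definition complex_dim :: "'a set set \<Rightarrow> int" where
  "complex_dim K = Max (face_dim ` K)"

definition vertices :: "'a set set \<Rightarrow> 'a set" where
  "vertices K = \<Union>K"

definition facets :: "'a set set \<Rightarrow> 'a set set" where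
  "facets K = {\<sigma>\<in>K. face_dim \<sigma> = complex_dim K}"

definition ridges :: "'a set set \<Rightarrow> 'a set set" where
  "ridges K = {\<sigma>\<in>K. face_dim \<sigma> = complex_dim K - 1}"

definition pure_complex :: "'a set set \<Rightarrow> bool" where
  "pure_complex K \<longleftrightarrow> abstract_complex K \<and> (\<forall>\<sigma>\<in>K. \<exists>\<tau>\<in>facets K. \<sigma> \<subseteq> \<tau>)"

text \<open>The dual graph has vertex set \<open>facets K\<close>; it is represented by its adjacency relation,
  which is symmetric, and irreflexive because a facet is not a ridge.\<close>

definition dual_graph :: "'a set set \<Rightarrow> ('a set \<times> 'a set) set" where
  "dual_graph K = {(\<sigma>, \<tau>). \<sigma> \<in> facets K \<and> \<tau> \<in> facets K \<and> \<sigma> \<inter> \<tau> \<in> ridges K}"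

definition strongly_connected_complex :: "'a set set \<Rightarrow> bool" where
  "strongly_connected_complex K \<longleftrightarrow>
     (\<forall>\<sigma>\<in>facets K. \<forall>\<tau>\<in>facets K. (\<sigma>, \<tau>) \<in> (dual_graph K)\<^sup>*)"

definition dual_dist :: "'a set set \<Rightarrow> 'a set \<Rightarrow> 'a set \<Rightarrow> nat" where
  "dual_dist K \<sigma> \<tau> = (LEAST k. (\<sigma>, \<tau>) \<in> dual_graph K ^^ k)"

text \<open>Graph distances are meaningful only if the dual graph is connected, so this is used
  for strongly connected complexes only.\<close>

definition comb_diameter :: "'a set set \<Rightarrow> nat" where
  "comb_diameter K = Max {dual_dist K \<sigma> \<tau> | \<sigma> \<tau>. \<sigma> \<in> facets K \<and> \<tau> \<in> facets K}"

definition pseudomanifold :: "int \<Rightarrow> 'a set set \<Rightarrow> bool" where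
  "pseudomanifold k K \<longleftrightarrow>
     pure_complex K \<and> complex_dim K = k \<and>
     (\<forall>\<rho>\<in>ridges K. card {\<sigma>\<in>facets K. \<rho> \<subseteq> \<sigma>} = 2)"

text \<open>Taking the vertices in \<open>nat\<close> is no restriction, since complexes are finite and the
  diameter is invariant under relabelling. There are such pseudomanifolds exactly
  if \<open>n > d\<close> (for \<open>d \<ge> 2\<close>); otherwise the value is unspecified.\<close>

definition H_pm :: "nat \<Rightarrow> nat \<Rightarrow> nat" where
  "H_pm n d = Max {comb_diameter K | K :: nat set set.
     pseudomanifold (int d - 1) K \<and> strongly_connected_complex K \<and> card (vertices K) = n}"

end

theory Submission
  imports Defs
begin

text \<open>
  Upper bound: a pseudomanifold with \<open>f\<close> facets has \<open>f d / 2\<close> ridges, so \<open>f \<le> 2 (n choose (d - 1)) / d\<close>.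
  In the \<open>d\<close>-regular dual graph pick one facet at each distance from an end of a diametral pair; their
  closed neighbourhoods cover every facet at most three times, so \<open>(diam + 1) (d + 1) \<le> 3 f\<close>.

  Lower bound: for a sequence \<open>v\<^sub>0, v\<^sub>1, \<dots>\<close> of vertices start with the boundary of the simplex
  on the first \<open>d + 1\<close> of them and then repeatedly stack the next vertex over the facet formed by the last
  \<open>d\<close>. If each stacking step creates only new ridges, the result is a pseudomanifold, and since adjacent facets
  are created at most two steps apart, its diameter is at least about half the length of the sequence. Long sequences
  of this kind exist by counting: if \<open>G m\<close> is the number of admissible sequences of length \<open>m\<close>, an
  extension that recreates an old ridge is determined by the sequence without its last \<open>d + 1\<close> entries up to
  a bounded number of choices and two free entries. With \<open>G m \<ge> \<beta>\<^sup>d G (m - d)\<close> for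
  \<open>\<beta> = n d / (d + 1)\<close> as induction hypothesis this gives \<open>G (m + 1) \<ge> \<beta> G m\<close> as long as \<open>m\<close> is at
  most of order \<open>n\<^bsup>d - 1\<^esup> / (d\<^sup>4 d!)\<close>. Appending unused vertices keeps a sequence admissible, so all \<open>n\<close>
  vertices can be used.
\<close>

section \<open>Facet systems\<close>

text \<open>A pure complex is determined by its facets, and stacking is easiest to describe on them.
  The last condition says that each ridge of the generated complex lies in exactly two
  facets.\<close>

definition facet_system :: "nat \<Rightarrow> 'a set set \<Rightarrow> bool" where
  "facet_system d \<F> \<longleftrightarrow> finite \<F> \<and> \<F> \<noteq> {} \<and> (\<forall>F\<in>\<F>. finite F \<and> card F = d) \<and>
     (\<forall>R. card R = d - 1 \<longrightarrow> (\<exists>F\<in>\<F>. R \<subseteq> F) \<longrightarrow> card {F\<in>\<F>. R \<subseteq> F} = 2)"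

definition facet_adj :: "nat \<Rightarrow> 'a set set \<Rightarrow> ('a set \<times> 'a set) set" where
  "facet_adj d \<F> = {(F, G). F \<in> \<F> \<and> G \<in> \<F> \<and> card (F \<inter> G) = d - 1}"

lemma facet_system_closure:
  fixes \<F> :: "'a set set"
  assumes "facet_system d \<F>" "d \<ge> 1"
  defines "K \<equiv> \<Union>(Pow ` \<F>)"
  shows "pseudomanifold (int d - 1) K" "facets K = \<F>" "vertices K = \<Union>\<F>"
    "dual_graph K = facet_adj d \<F>"
proof -
  have fin: "finite \<F>" and ne: "\<F> \<noteq> {}" and fF: "\<And>F. F \<in> \<F> \<Longrightarrow> finite F"
    and cF: "\<And>F. F \<in> \<F> \<Longrightarrow> card F = d"
    and two: "\<And>R. card R = d - 1 \<Longrightarrow> (\<exists>F\<in>\<F>. R \<subseteq> F) \<Longrightarrow> card {F\<in>\<F>. R \<subseteq> F} = 2"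
    using assms(1) by (auto simp: facet_system_def)
  have Kiff: "s \<in> K \<longleftrightarrow> (\<exists>F\<in>\<F>. s \<subseteq> F)" for s by (auto simp: K_def)
  have finK: "finite K" unfolding K_def using fin fF by auto
  have ac: "abstract_complex K"
    unfolding abstract_complex_def using finK ne fF
    by (auto simp: K_def intro: finite_subset)
  obtain F0 where F0: "F0 \<in> \<F>" using ne by auto
  have dim: "complex_dim K = int d - 1"
    unfolding complex_dim_def
  proof (rule Max_eqI)
    show "finite (face_dim ` K)" using finK by auto
    show "y \<le> int d - 1" if y: "y \<in> face_dim ` K" for y
    proof -
      obtain s F where "y = face_dim s" "F \<in> \<F>" "s \<subseteq> F" using y Kiff by auto
      then show ?thesis using card_mono[of F s] fF cF by (auto simp: face_dim_def)
    qed
    show "int d - 1 \<in> face_dim ` K"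
      using F0 cF by (intro image_eqI[of _ _ F0]) (auto simp: Kiff face_dim_def)
  qed
  show fac: "facets K = \<F>"
  proof
    show "facets K \<subseteq> \<F>"
    proof
      fix s assume "s \<in> facets K"
      then obtain F where F: "F \<in> \<F>" "s \<subseteq> F" "card s = d"
        by (auto simp: facets_def dim face_dim_def Kiff)
      then have "s = F" using card_subset_eq[of F s] fF cF by auto
      then show "s \<in> \<F>" using F by simp
    qed
    show "\<F> \<subseteq> facets K" using cF by (auto simp: facets_def dim face_dim_def Kiff)
  qed
  have rid: "ridges K = {R. card R = d - 1 \<and> (\<exists>F\<in>\<F>. R \<subseteq> F)}"
    using assms(2) by (auto simp: ridges_def dim face_dim_def Kiff)
  show "vertices K = \<Union>\<F>" by (auto simp: vertices_def K_def)
  show "dual_graph K = facet_adj d \<F>"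
    unfolding dual_graph_def facet_adj_def fac rid by auto
  show "pseudomanifold (int d - 1) K"
    unfolding pseudomanifold_def pure_complex_def fac rid dim using ac two
    by (auto simp: Kiff)
qed

text \<open>Converse of \<open>facet_system_closure\<close>: it lets the upper bound, which concerns
  arbitrary pseudomanifolds, be proved on facets alone.\<close>

lemma pseudomanifold_facet_system:
  fixes K :: "'a set set"
  assumes "pseudomanifold (int d - 1) K" "d \<ge> 1"
  shows "facet_system d (facets K)" "dual_graph K = facet_adj d (facets K)"
    "vertices K = \<Union>(facets K)"
proof -
  have ac: "abstract_complex K" and pure: "\<And>s. s \<in> K \<Longrightarrow> \<exists>F\<in>facets K. s \<subseteq> F"
    and dim: "complex_dim K = int d - 1"
    and two: "\<And>R. R \<in> ridges K \<Longrightarrow> card {F\<in>facets K. R \<subseteq> F} = 2"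
    using assms(1) by (auto simp: pseudomanifold_def pure_complex_def)
  have rid: "R \<in> ridges K" if "card R = d - 1" "F \<in> facets K" "R \<subseteq> F" for R F
    using that ac assms(2) by (auto simp: ridges_def dim face_dim_def facets_def abstract_complex_def)
  have cF: "card F = d" "finite F" "F \<in> K" if "F \<in> facets K" for F
    using that ac by (auto simp: facets_def dim face_dim_def abstract_complex_def)
  have fin: "finite (facets K)" using ac by (auto simp: facets_def abstract_complex_def)
  have ne: "facets K \<noteq> {}" using ac pure by (fastforce simp: abstract_complex_def)
  show "facet_system d (facets K)"
    unfolding facet_system_def using fin ne cF rid two by blast
  show "dual_graph K = facet_adj d (facets K)"
    unfolding dual_graph_def facet_adj_def
  proof (intro set_eqI iffI; clarsimp)
    fix F G assume "F \<inter> G \<in> ridges K"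
    then show "card (F \<inter> G) = d - Suc 0"
      using assms(2) by (auto simp: ridges_def dim face_dim_def)
  next
    fix F G assume "F \<in> facets K" "card (F \<inter> G) = d - Suc 0"
    then show "F \<inter> G \<in> ridges K" using rid[of "F \<inter> G" F] by auto
  qed
  show "vertices K = \<Union>(facets K)"
    unfolding vertices_def using pure cF(3) by blast
qed

section \<open>The upper bound\<close>

text \<open>Double counting of incidences between facets and sets of size d - 1: each facet contains
  d such sets, and each such subset of V lies in two facets or in none.\<close>

lemma facet_count_le:
  assumes fs: "facet_system d \<F>" and d: "d \<ge> 1" and V: "finite V" "\<Union>\<F> \<subseteq> V"
  shows "d * card \<F> \<le> 2 * (card V choose (d - 1))"
proof -
  have fin: "finite \<F>" and cF: "\<And>F. F \<in> \<F> \<Longrightarrow> finite F \<and> card F = d"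
    using fs by (auto simp: facet_system_def)
  define \<R> where "\<R> = {R. R \<subseteq> V \<and> card R = d - 1}"
  have finR: "finite \<R>" using V by (auto simp: \<R>_def)
  have "d * card \<F> = (\<Sum>F\<in>\<F>. card {R\<in>\<R>. R \<subseteq> F})"
  proof -
    have "card {R\<in>\<R>. R \<subseteq> F} = d" if "F \<in> \<F>" for F
    proof -
      have "{R\<in>\<R>. R \<subseteq> F} = {R. R \<subseteq> F \<and> card R = d - 1}" using that V by (auto simp: \<R>_def)
      then have "card {R\<in>\<R>. R \<subseteq> F} = d choose (d - 1)" using n_subsets[of F "d - 1"] cF[OF that] by simp
      also have "\<dots> = d" using binomial_symmetric[of "d - 1" d] d by simp
      finally show ?thesis .
    qed
    then show ?thesis by simp
  qed
  also have "\<dots> = (\<Sum>R\<in>\<R>. card {F\<in>\<F>. R \<subseteq> F})"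
    using sum_multicount_gen[OF fin finR, of "\<lambda>F R. R \<subseteq> F" "\<lambda>R. card {F\<in>\<F>. R \<subseteq> F}"] by simp
  also have "\<dots> \<le> (\<Sum>R\<in>\<R>. 2)"
  proof (rule sum_mono)
    fix R assume R: "R \<in> \<R>"
    show "card {F\<in>\<F>. R \<subseteq> F} \<le> 2"
    proof (cases "\<exists>F\<in>\<F>. R \<subseteq> F")
      case True
      then show ?thesis using fs R by (auto simp: facet_system_def \<R>_def)
    next
      case False
      then have "{F\<in>\<F>. R \<subseteq> F} = {}" by auto
      then show ?thesis by (metis card.empty zero_le)
    qed
  qed
  also have "\<dots> = 2 * (card V choose (d - 1))"
    using n_subsets[OF V(1), of "d - 1"] by (simp add: \<R>_def)
  finally show ?thesis .
qed

text \<open>Across the ridge \<open>F - {x}\<close> lies a second facet \<open>N x\<close>. It meets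
  \<open>F\<close> in exactly this ridge, so x can be recovered from it and the d neighbours
  obtained are distinct.\<close>

lemma facet_neighbours:
  assumes fs: "facet_system d \<F>" and d: "d \<ge> 1" and F: "F \<in> \<F>"
  shows "d + 1 \<le> card (insert F {G. (F, G) \<in> facet_adj d \<F>})"
proof -
  have fin: "finite \<F>" and cF: "\<And>F. F \<in> \<F> \<Longrightarrow> finite F \<and> card F = d"
    and two: "\<And>R. card R = d - 1 \<Longrightarrow> (\<exists>F\<in>\<F>. R \<subseteq> F) \<Longrightarrow> card {F\<in>\<F>. R \<subseteq> F} = 2"
    using fs by (auto simp: facet_system_def)
  have "\<exists>G\<in>\<F>. G \<noteq> F \<and> F - {x} \<subseteq> G" if "x \<in> F" for x
  proof -
    have "card (F - {x}) = d - 1" using that cF[OF F] by simp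
    then have "card {G\<in>\<F>. F - {x} \<subseteq> G} = 2" using two F by blast
    then have "\<not> {G\<in>\<F>. F - {x} \<subseteq> G} \<subseteq> {F}" using card_mono[of "{F}" "{G\<in>\<F>. F - {x} \<subseteq> G}"] by auto
    then show ?thesis by blast
  qed
  then obtain N where N: "\<And>x. x \<in> F \<Longrightarrow> N x \<in> \<F> \<and> N x \<noteq> F \<and> F - {x} \<subseteq> N x" by metis
  have notin: "x \<notin> N x" if "x \<in> F" for x
  proof
    assume "x \<in> N x"
    then have "F \<subseteq> N x" using N[OF that] by auto
    then show False using N[OF that] cF[OF F] cF[of "N x"] card_subset_eq[of "N x" F] by auto
  qed
  have inter: "F \<inter> N x = F - {x}" if "x \<in> F" for x using N[OF that] notin[OF that] by auto
  have inj: "inj_on N F"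
    by (rule inj_onI) (metis inter DiffD2 Diff_iff insertI1 singletonD)
  have "N ` F \<subseteq> {G. (F, G) \<in> facet_adj d \<F>}"
    using N inter cF[OF F] F by (auto simp: facet_adj_def)
  then have sub: "insert F (N ` F) \<subseteq> insert F {G. (F, G) \<in> facet_adj d \<F>}" by auto
  have "finite {G. (F, G) \<in> facet_adj d \<F>}"
    by (rule finite_subset[OF _ fin]) (auto simp: facet_adj_def)
  then have "card (insert F (N ` F)) \<le> card (insert F {G. (F, G) \<in> facet_adj d \<F>})"
    using sub by (intro card_mono) auto
  moreover have "card (insert F (N ` F)) = d + 1"
    using N cF[OF F] card_image[OF inj] by (subst card_insert_disjoint) auto
  ultimately show ?thesis by simp
qed

section \<open>Distances in the dual graph and the resulting diameter bound\<close>

lemma dual_dist_le_relpow: "(F, G) \<in> dual_graph K ^^ k \<Longrightarrow> dual_dist K F G \<le> k"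
  unfolding dual_dist_def by (rule Least_le)

lemma dual_dist_relpow:
  assumes "strongly_connected_complex K" "F \<in> facets K" "G \<in> facets K"
  shows "(F, G) \<in> dual_graph K ^^ dual_dist K F G"
proof -
  have "(F, G) \<in> (dual_graph K)\<^sup>*" using assms by (auto simp: strongly_connected_complex_def)
  then obtain k where "(F, G) \<in> dual_graph K ^^ k" using rtrancl_imp_relpow by blast
  then show ?thesis unfolding dual_dist_def by (rule LeastI)
qed

text \<open>Choose one facet at each distance \<open>0, \<dots>, D\<close> from \<open>\<sigma>\<close>. Closed neighbourhoods in the dual
  graph have \<open>d + 1\<close> elements, and a facet can only lie in those of three consecutive distances.\<close>

lemma dual_dist_le_facets:
  assumes pm: "pseudomanifold (int d - 1) K" and sc: "strongly_connected_complex K" and d: "d \<ge> 1"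
    and S: "\<sigma> \<in> facets K" "\<tau> \<in> facets K"
  shows "(dual_dist K \<sigma> \<tau> + 1) * (d + 1) \<le> 3 * card (facets K)"
proof -
  define \<F> where "\<F> = facets K"
  define r where "r = facet_adj d \<F>"
  define \<delta> where "\<delta> = dual_dist K \<sigma>"
  define D where "D = \<delta> \<tau>"
  have fs: "facet_system d \<F>" and r: "dual_graph K = r"
    using pseudomanifold_facet_system[OF pm d] by (auto simp: \<F>_def r_def)
  have fin: "finite \<F>" using fs by (auto simp: facet_system_def)
  have sym: "(G, F) \<in> r" if "(F, G) \<in> r" for F G
    using that by (auto simp: r_def facet_adj_def Int_commute)
  have rF: "F \<in> \<F> \<and> G \<in> \<F>" if "(F, G) \<in> r" for F G
    using that by (auto simp: r_def facet_adj_def)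
  have pow: "(\<sigma>, F) \<in> r ^^ \<delta> F" if "F \<in> \<F>" for F
    using dual_dist_relpow[OF sc S(1)] that by (auto simp: \<F>_def \<delta>_def r)
  have le: "\<delta> F \<le> k" if "(\<sigma>, F) \<in> r ^^ k" for F k
    using dual_dist_le_relpow[of \<sigma> F k K] that by (simp add: \<delta>_def r)
  have lip: "\<delta> G \<le> \<delta> F + 1" if "(F, G) \<in> r" for F G
  proof -
    have "(\<sigma>, G) \<in> r ^^ Suc (\<delta> F)" using pow[of F] rF[OF that] that by auto
    then show ?thesis using le by fastforce
  qed
  \<comment> \<open>Take the facet reached after i steps of a shortest walk to
    \<open>\<tau>\<close>; a distance below i would give a walk to \<open>\<tau>\<close> of length
    below D.\<close>
  have "\<exists>P\<in>\<F>. \<delta> P = i" if i: "i \<le> D" for i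
  proof -
    have "(\<sigma>, \<tau>) \<in> r ^^ (i + (D - i))" using pow[of \<tau>] S i by (simp add: D_def \<F>_def)
    then obtain P where P: "(\<sigma>, P) \<in> r ^^ i" "(P, \<tau>) \<in> r ^^ (D - i)" by (auto simp: relpow_add)
    have PF: "P \<in> \<F>"
    proof (cases i)
      case 0 then show ?thesis using P S by (simp add: \<F>_def)
    next
      case (Suc j)
      then show ?thesis using P(1) rF by auto
    qed
    have "(\<sigma>, \<tau>) \<in> r ^^ (\<delta> P + (D - i))" unfolding relpow_add using pow[OF PF] P(2) by auto
    then have "D \<le> \<delta> P + (D - i)" using le by (auto simp: D_def)
    moreover have "\<delta> P \<le> i" using P(1) le by auto
    ultimately show ?thesis using i PF by (intro bexI[of _ P]) auto
  qed
  then obtain P where P: "\<And>i. i \<le> D \<Longrightarrow> P i \<in> \<F> \<and> \<delta> (P i) = i" by metis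
  define N where "N i = insert (P i) {G. (P i, G) \<in> r}" for i
  have Nsub: "N i \<subseteq> \<F>" if "i \<le> D" for i using P[OF that] rF by (auto simp: N_def)
  have "(D + 1) * (d + 1) = (\<Sum>i\<in>{..D}. d + 1)" by simp
  also have "\<dots> \<le> (\<Sum>i\<in>{..D}. card (N i))"
    by (rule sum_mono) (use facet_neighbours[OF fs d] P in \<open>auto simp: N_def r_def\<close>)
  also have "\<dots> = (\<Sum>i\<in>{..D}. card {F\<in>\<F>. F \<in> N i})"
    by (intro sum.cong refl arg_cong[of _ _ card]) (use Nsub in auto)
  also have "\<dots> = (\<Sum>F\<in>\<F>. card {i\<in>{..D}. F \<in> N i})"
    using sum_multicount_gen[of "{..D}" \<F> "\<lambda>i F. F \<in> N i" "\<lambda>F. card {i\<in>{..D}. F \<in> N i}"] fin by simp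
  also have "\<dots> \<le> (\<Sum>F\<in>\<F>. 3)"
  proof (rule sum_mono)
    fix F assume "F \<in> \<F>"
    \<comment> \<open>Distances change by at most one along an edge. For
      \<open>\<delta> F = 0\<close> the truncated subtraction only repeats 0.\<close>
    have "{i\<in>{..D}. F \<in> N i} \<subseteq> {\<delta> F - 1, \<delta> F, \<delta> F + 1}"
    proof
      fix i assume "i \<in> {i\<in>{..D}. F \<in> N i}"
      then have i: "i \<le> D" "F \<in> N i" by auto
      then consider "F = P i" | "(P i, F) \<in> r" by (auto simp: N_def)
      then show "i \<in> {\<delta> F - 1, \<delta> F, \<delta> F + 1}"
      proof cases
        case 1 then show ?thesis using P i by auto
      next
        case 2
        then show ?thesis using lip[OF 2] lip[OF sym[OF 2]] P[OF i(1)] by auto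
      qed
    qed
    then have "card {i\<in>{..D}. F \<in> N i} \<le> card {\<delta> F - 1, \<delta> F, \<delta> F + 1}"
      by (intro card_mono) auto
    also have "\<dots> \<le> 3" by (simp add: card_insert_if)
    finally show "card {i\<in>{..D}. F \<in> N i} \<le> 3" .
  qed
  also have "\<dots> = 3 * card \<F>" by simp
  finally show ?thesis by (simp add: D_def \<delta>_def \<F>_def)
qed

lemma comb_diameter_upper:
  assumes pm: "pseudomanifold (int d - 1) K" and sc: "strongly_connected_complex K" and d: "d \<ge> 1"
    and V: "finite (vertices K)"
  shows "comb_diameter K * (d * (d + 1)) \<le> 6 * (card (vertices K) choose (d - 1))"
proof -
  have fs: "facet_system d (facets K)" and ver: "vertices K = \<Union>(facets K)"
    using pseudomanifold_facet_system[OF pm d] by auto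
  have fin: "finite (facets K)" "facets K \<noteq> {}" using fs by (auto simp: facet_system_def)
  let ?S = "{dual_dist K \<sigma> \<tau> | \<sigma> \<tau>. \<sigma> \<in> facets K \<and> \<tau> \<in> facets K}"
  have eq: "?S = (\<lambda>(s, t). dual_dist K s t) ` (facets K \<times> facets K)" by auto
  have "comb_diameter K \<in> ?S"
    unfolding comb_diameter_def by (rule Max_in) (use fin in \<open>auto simp: eq\<close>)
  then obtain s t where st: "s \<in> facets K" "t \<in> facets K" "comb_diameter K = dual_dist K s t" by auto
  have "comb_diameter K * (d + 1) \<le> 3 * card (facets K)"
    using dual_dist_le_facets[OF pm sc d st(1,2)] by (simp add: st(3))
  then have "comb_diameter K * (d * (d + 1)) \<le> 3 * (d * card (facets K))"
    by (metis mult.left_commute mult_le_mono2)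
  also have "\<dots> \<le> 3 * (2 * (card (vertices K) choose (d - 1)))"
    using facet_count_le[OF fs d V] ver by simp
  finally show ?thesis by simp
qed

section \<open>Stacking\<close>

text \<open>Stellar subdivision of the facet \<open>F\<close>, except that the apex u may already be
  a vertex elsewhere: \<open>F\<close> is replaced by the cone from u over its boundary.\<close>

definition stack :: "'a \<Rightarrow> 'a set \<Rightarrow> 'a set set \<Rightarrow> 'a set set" where
  "stack u F \<F> = (\<F> - {F}) \<union> (\<lambda>x. insert u (F - {x})) ` F"

text \<open>A ridge created by stacking consists of u and d - 2 vertices of \<open>F\<close>. The
  assumption \<open>fresh\<close> keeps all of these out of the old facets, so none ends up in more
  than two facets, even if u is an old vertex.\<close>

context
  fixes d :: nat and \<F> :: "'a set set" and F :: "'a set" and u :: 'a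
  assumes d: "d \<ge> 3" and fs: "facet_system d \<F>" and F: "F \<in> \<F>" and uF: "u \<notin> F"
    and fresh: "\<And>S G. S \<subseteq> F \<Longrightarrow> card S = d - 2 \<Longrightarrow> G \<in> \<F> \<Longrightarrow> \<not> insert u S \<subseteq> G"
begin

private lemma fin: "finite \<F>" and card_facet: "\<And>G. G \<in> \<F> \<Longrightarrow> finite G \<and> card G = d"
  and two: "\<And>R. card R = d - 1 \<Longrightarrow> (\<exists>F\<in>\<F>. R \<subseteq> F) \<Longrightarrow> card {F\<in>\<F>. R \<subseteq> F} = 2"
  using fs by (auto simp: facet_system_def)

private lemma finF: "finite F" "card F = d" using card_facet[OF F] by auto

private lemma card_new: "x \<in> F \<Longrightarrow> finite (insert u (F - {x})) \<and> card (insert u (F - {x})) = d"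
  using uF finF d by auto

private lemma card_F2: "x \<in> F \<Longrightarrow> y \<in> F \<Longrightarrow> x \<noteq> y \<Longrightarrow> card (F - {x, y}) = d - 2"
  using finF d card_Diff_subset[of "{x,y}" F] by auto

lemma stack_new_notin:
  assumes "insert u S \<subseteq> G" "S \<subseteq> F" "card S \<ge> d - 2"
  shows "G \<notin> \<F>"
proof
  assume G: "G \<in> \<F>"
  obtain T where "T \<subseteq> S" "card T = d - 2" using obtain_subset_with_card_n[OF assms(3)] by metis
  then show False using fresh[of T G] assms G by blast
qed

private lemma new_notin: "x \<in> F \<Longrightarrow> insert u (F - {x}) \<notin> \<F>"
  by (rule stack_new_notin[of "F - {x}"]) (use finF in auto)

private lemma inj_new: "x \<in> F \<Longrightarrow> y \<in> F \<Longrightarrow> insert u (F - {x}) = insert u (F - {y}) \<Longrightarrow> x = y"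
  using uF by (metis insert_iff Diff_iff singletonD singletonI)

text \<open>There are three kinds of ridges. Those not inside \<open>insert u F\<close> keep their
  facets. One containing u misses two vertices of \<open>F\<close> and lies in the two new facets
  omitting them. For \<open>F - {x}\<close>, the facet \<open>F\<close> is exchanged for
  \<open>insert u (F - {x})\<close>.\<close>

lemma stack_facet_system: "facet_system d (stack u F \<F>)"
  unfolding facet_system_def
proof (intro conjI allI impI ballI)
  show "finite (stack u F \<F>)" using fin finF by (auto simp: stack_def)
  have "F \<noteq> {}" using finF d by auto
  then show "stack u F \<F> \<noteq> {}" by (auto simp: stack_def)
  show "finite G" "card G = d" if "G \<in> stack u F \<F>" for G
    using that card_new card_facet by (auto simp: stack_def)
  fix R assume cR: "card R = d - 1" and ex: "\<exists>G\<in>stack u F \<F>. R \<subseteq> G"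
  have finR: "finite R" using cR d by (intro card_ge_0_finite) auto
  show "card {G \<in> stack u F \<F>. R \<subseteq> G} = 2"
  proof (cases "R \<subseteq> insert u F")
    case False
    then have eq: "{G \<in> stack u F \<F>. R \<subseteq> G} = {G \<in> \<F>. R \<subseteq> G}" by (auto simp: stack_def)
    then have "\<exists>G\<in>\<F>. R \<subseteq> G" using ex by blast
    then show ?thesis unfolding eq using two cR by blast
  next
    case sub: True
    show ?thesis
    proof (cases "u \<in> R")
      case True
      define S where "S = R - {u}"
      have S: "S \<subseteq> F" "R = insert u S" "card S = d - 2" "u \<notin> S"
        using True sub cR finR by (auto simp: S_def)
      have "card (F - S) = 2" using S finF d card_Diff_subset[of S F] finite_subset[of S F] by auto
      then obtain x y where xy: "F - S = {x, y}" "x \<noteq> y" by (auto simp: card_2_iff)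
      have "{G \<in> stack u F \<F>. R \<subseteq> G} = {insert u (F - {x}), insert u (F - {y})}"
      proof (intro subset_antisym subsetI)
        fix G assume "G \<in> {G \<in> stack u F \<F>. R \<subseteq> G}"
        then have G: "G \<in> stack u F \<F>" "R \<subseteq> G" by auto
        have "G \<notin> \<F>" using fresh[of S G] S G by blast
        then obtain z where z: "z \<in> F" "G = insert u (F - {z})" using G by (auto simp: stack_def)
        then have "z \<in> F - S" using G S uF by auto
        then show "G \<in> {insert u (F - {x}), insert u (F - {y})}" using z xy by auto
      next
        fix G assume "G \<in> {insert u (F - {x}), insert u (F - {y})}"
        then show "G \<in> {G \<in> stack u F \<F>. R \<subseteq> G}" using xy S by (auto simp: stack_def)
      qed
      moreover have "insert u (F - {x}) \<noteq> insert u (F - {y})" using inj_new[of x y] xy by blast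
      ultimately show ?thesis by simp
    next
      case False
      then have RF: "R \<subseteq> F" using sub by auto
      then have "card (F - R) = 1" using finF finR cR d card_Diff_subset[of R F] by auto
      then obtain x where x: "F - R = {x}" by (auto simp: card_1_singleton_iff)
      then have Rx: "R = F - {x}" "x \<in> F" using RF by auto
      have c2: "card {G\<in>\<F>. R \<subseteq> G} = 2" using two cR F RF by blast
      have "{G \<in> stack u F \<F>. R \<subseteq> G} = insert (insert u (F - {x})) ({G\<in>\<F>. R \<subseteq> G} - {F})"
        using Rx uF by (auto simp: stack_def)
      then show ?thesis using c2 new_notin[OF Rx(2)] F RF fin by (simp add: card_Diff_singleton)
    qed
  qed
qed

lemma stack_Union: "\<Union>(stack u F \<F>) = insert u (\<Union>\<F>)"
proof -
  have ex: "\<exists>y\<in>F. x \<noteq> y" for x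
  proof (rule ccontr)
    assume "\<not> (\<exists>y\<in>F. x \<noteq> y)"
    then have "F \<subseteq> {x}" by auto
    then have "card F \<le> 1" using card_mono[of "{x}" F] by auto
    then show False using finF d by auto
  qed
  have "F \<noteq> {}" using ex[of undefined] by auto
  moreover have "z \<in> (\<Union>x\<in>F. insert u (F - {x}))" if "z \<in> F" for z
    using ex[of z] that by auto
  ultimately have "(\<Union>x\<in>F. insert u (F - {x})) = insert u F" by auto
  then have "\<Union>(stack u F \<F>) = \<Union>(\<F> - {F}) \<union> insert u F" by (simp add: stack_def)
  moreover have "\<Union>(\<F> - {F}) \<union> F = \<Union>\<F>" using F by blast
  ultimately show ?thesis by blast
qed

lemma stack_connected:
  assumes conn: "\<And>G H. G \<in> \<F> \<Longrightarrow> H \<in> \<F> \<Longrightarrow> (G, H) \<in> (facet_adj d \<F>)\<^sup>*"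
    and GH: "G \<in> stack u F \<F>" "H \<in> stack u F \<F>"
  shows "(G, H) \<in> (facet_adj d (stack u F \<F>))\<^sup>*"
proof -
  define r where "r = facet_adj d (stack u F \<F>)"
  define N where "N x = insert u (F - {x})" for x
  have new: "(N x, N y) \<in> r\<^sup>*" if "x \<in> F" "y \<in> F" for x y
  proof (cases "x = y")
    case False
    have "N x \<inter> N y = insert u (F - {x, y})" by (auto simp: N_def)
    then have "card (N x \<inter> N y) = d - 1"
      using card_F2[OF that False] uF finF d by simp
    then show ?thesis using that by (auto simp: r_def facet_adj_def stack_def N_def)
  qed auto
  obtain x0 where x0: "x0 \<in> F" using finF d by fastforce
  \<comment> \<open>Old walks are transported by sending the deleted facet to one fixed new facet.
    This works because the new facets are pairwise adjacent and every former neighbour of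
    \<open>F\<close> is adjacent to one of them.\<close>
  define \<phi> where "\<phi> G = (if G = F then N x0 else G)" for G
  have symr: "sym r" by (auto simp: r_def facet_adj_def Int_commute sym_def)
  then have syms: "(B, A) \<in> r\<^sup>*" if "(A, B) \<in> r\<^sup>*" for A B
    using sym_rtrancl[OF symr] that by (auto simp: sym_def)
  have step1: "(N x0, B) \<in> r\<^sup>*" if "(F, B) \<in> facet_adj d \<F>" "B \<noteq> F" for B
  proof -
    have B: "B \<in> \<F>" "card (F \<inter> B) = d - 1" using that by (auto simp: facet_adj_def)
    then have "card (F - F \<inter> B) = 1" using finF d card_Diff_subset[of "F \<inter> B" F] by auto
    then obtain x where x: "F - F \<inter> B = {x}" by (auto simp: card_1_singleton_iff)
    \<comment> \<open>Otherwise \<open>B\<close> would contain u together with d - 1 vertices of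
      \<open>F\<close>, contrary to \<open>fresh\<close>.\<close>
    have "u \<notin> B"
    proof
      assume "u \<in> B"
      then have "B \<notin> \<F>" by (intro stack_new_notin[of "F \<inter> B"]) (use B in auto)
      then show False using B by simp
    qed
    then have "N x \<inter> B = F \<inter> B" using x by (auto simp: N_def)
    then have "(N x, B) \<in> r" using B x that by (auto simp: r_def facet_adj_def stack_def N_def)
    then show ?thesis using new[OF x0, of x] x by (auto intro: rtrancl_into_rtrancl)
  qed
  have step: "(\<phi> A, \<phi> B) \<in> r\<^sup>*" if "(A, B) \<in> facet_adj d \<F>" for A B
  proof (cases "A = F")
    case True
    then show ?thesis using step1[of B] that by (auto simp: \<phi>_def)
  next
    case A: False
    show ?thesis
    proof (cases "B = F")
      case True
      then have "(F, A) \<in> facet_adj d \<F>" using that by (auto simp: facet_adj_def Int_commute)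
      then show ?thesis using step1[of A] syms A True by (auto simp: \<phi>_def)
    next
      case False
      then have "(A, B) \<in> r" using that A by (auto simp: r_def facet_adj_def stack_def)
      then show ?thesis using A False by (auto simp: \<phi>_def)
    qed
  qed
  have lift: "(\<phi> A, \<phi> B) \<in> r\<^sup>*" if "(A, B) \<in> (facet_adj d \<F>)\<^sup>*" for A B
    using that by induction (auto intro: rtrancl_trans step)
  have to: "\<exists>A\<in>\<F>. (\<phi> A, G) \<in> r\<^sup>*" if G: "G \<in> stack u F \<F>" for G
  proof (cases "G \<in> \<F> - {F}")
    case True then show ?thesis by (intro bexI[of _ G]) (auto simp: \<phi>_def)
  next
    case False
    then have "G \<in> N ` F" using G unfolding stack_def N_def by (elim UnE) simp_all
    then obtain x where "x \<in> F" "G = N x" by blast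
    then have "(\<phi> F, G) \<in> r\<^sup>*" using new[OF x0] by (simp add: \<phi>_def)
    then show ?thesis using F by blast
  qed
  obtain A B where AB: "A \<in> \<F>" "B \<in> \<F>" "(\<phi> A, G) \<in> r\<^sup>*" "(\<phi> B, H) \<in> r\<^sup>*"
    using to[OF GH(1)] to[OF GH(2)] by blast
  have "(G, \<phi> B) \<in> r\<^sup>*" using syms[OF AB(3)] lift[OF conn[OF AB(1,2)]] by (rule rtrancl_trans)
  then show ?thesis using AB(4) unfolding r_def[symmetric] by (rule rtrancl_trans)
qed

end

section \<open>Stacked spheres along a vertex sequence\<close>

text \<open>Vertices are listed newest first. The last condition concerns only windows disjoint from the last
  \<open>d\<close> positions; the more recent ones cannot contain \<open>u\<close> by the second condition.\<close>

fun good :: "nat \<Rightarrow> 'a list \<Rightarrow> bool" where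
  "good d [] = True"
| "good d (u # w) \<longleftrightarrow> good d w \<and> u \<notin> set (take (2 * d + 1) w) \<and>
     (\<forall>j\<ge>d. \<forall>S. S \<subseteq> set (take d w) \<longrightarrow> card S = d - 2 \<longrightarrow>
        \<not> insert u S \<subseteq> set (take (d + 1) (drop j w)))"

section \<open>Elementary properties of good lists\<close>

lemma good_append_unused:
  assumes "good d w" "distinct us" "set us \<inter> set w = {}"
  shows "good d (us @ w)"
  using assms(2,3)
proof (induction us)
  case (Cons u us)
  have "u \<notin> set (us @ w)" using Cons.prems by auto
  then have u: "u \<notin> set (take k (drop j (us @ w)))" for j k
    by (meson in_set_takeD in_set_dropD)
  show ?case using Cons u[of _ 0] u by simp
qed (use assms(1) in auto)

text \<open>Every entry differs from the 2d + 1 entries that precede it in time, hence no repetition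
  fits into 2d + 2 consecutive positions.\<close>

lemma good_take_distinct:
  assumes "good d w" "k \<le> 2 * d + 2"
  shows "distinct (take k w)"
  using assms
proof (induction w arbitrary: k)
  case (Cons u w)
  show ?case
  proof (cases k)
    case (Suc l)
    have "set (take l w) \<subseteq> set (take (2 * d + 1) w)" using Suc Cons.prems by (intro set_take_subset_set_take) auto
    then show ?thesis using Cons Suc by auto
  qed auto
qed auto

lemma good_drop: "good d w \<Longrightarrow> good d (drop k w)"
proof (induction w arbitrary: k)
  case (Cons u w) then show ?case by (cases k) auto
qed auto

text \<open>The complex spanned by the windows of \<open>w\<close> is a stacked ball whose newest vertex is the head
  of \<open>w\<close>, and \<open>\<F>\<close> consists of its boundary facets. The level of a facet is the time at which it was
  created; crossing a ridge changes the level by at most two.\<close>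

definition stacked_sphere :: "nat \<Rightarrow> 'a list \<Rightarrow> 'a set set \<Rightarrow> ('a set \<Rightarrow> nat) \<Rightarrow> bool" where
  "stacked_sphere d w \<F> lev \<longleftrightarrow>
     facet_system d \<F> \<and>
     (\<forall>G\<in>\<F>. \<forall>H\<in>\<F>. (G, H) \<in> (facet_adj d \<F>)\<^sup>*) \<and>
     \<Union>\<F> = set w \<and>
     set (take d w) \<in> \<F> \<and>
     (\<forall>G\<in>\<F>. \<exists>j. G \<subseteq> set (take (d + 1) (drop j w))) \<and>
     (\<forall>G\<in>\<F>. lev G \<le> length w) \<and>
     lev (set (take d w)) = length w \<and>
     (\<forall>G H. (G, H) \<in> facet_adj d \<F> \<longrightarrow> lev G \<le> lev H + 2) \<and>
     (\<forall>G\<in>\<F>. \<forall>x\<in>set (take d w). set (take d w) - {x} \<subseteq> G \<longrightarrow>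
        length w \<le> lev G + 1 \<and> (x \<noteq> hd w \<longrightarrow> length w \<le> lev G)) \<and>
     (\<exists>G\<in>\<F>. G \<noteq> set (take d w) \<and> lev G = d + 1)"

text \<open>The boundary of a d-simplex, with all facets regarded as created together. Any two of
  them are adjacent, and the constant level makes the level conditions trivial.\<close>

lemma stacked_sphere_base:
  assumes d: "d \<ge> 3" and w: "distinct w" "length w = d + 1"
  shows "stacked_sphere d w ((\<lambda>x. set w - {x}) ` set w) (\<lambda>_. d + 1)"
proof -
  define W where "W = set w"
  have cW: "card W = d + 1" "finite W" using w by (auto simp: W_def distinct_card)
  define \<F> where "\<F> = (\<lambda>x. W - {x}) ` W"
  obtain l where l: "w ! d = l" by auto
  have wl: "w = take d w @ [l]" using take_Suc_conv_app_nth[of d w] w(2) l by simp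
  have "distinct (take d w @ [l])" "W = set (take d w @ [l])" using wl w(1) W_def by simp_all
  then have F: "set (take d w) = W - {l}" "l \<in> W" by auto
  have fs: "facet_system d \<F>"
    unfolding facet_system_def
  proof (intro conjI allI impI ballI)
    show "finite \<F>" using cW by (auto simp: \<F>_def)
    show "\<F> \<noteq> {}" using F by (auto simp: \<F>_def)
    show "finite G" "card G = d" if "G \<in> \<F>" for G using that cW by (auto simp: \<F>_def)
    fix R assume cR: "card R = d - 1" and "\<exists>G\<in>\<F>. R \<subseteq> G"
    then have RW: "R \<subseteq> W" by (auto simp: \<F>_def)
    then have "card (W - R) = 2" using cW cR d card_Diff_subset[of R W] finite_subset[of R W] by auto
    moreover have "{G\<in>\<F>. R \<subseteq> G} = (\<lambda>x. W - {x}) ` (W - R)" using RW by (auto simp: \<F>_def)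
    moreover have "inj_on (\<lambda>x. W - {x}) (W - R)" by (rule inj_onI) blast
    ultimately show "card {G\<in>\<F>. R \<subseteq> G} = 2" by (simp add: card_image)
  qed
  have adj: "(W - {x}, W - {y}) \<in> (facet_adj d \<F>)\<^sup>*" if "x \<in> W" "y \<in> W" for x y
  proof (cases "x = y")
    case False
    have "(W - {x}) \<inter> (W - {y}) = W - {x, y}" by auto
    then have "card ((W - {x}) \<inter> (W - {y})) = d - 1"
      using cW that False card_Diff_subset[of "{x,y}" W] by simp
    then show ?thesis using that by (auto simp: facet_adj_def \<F>_def)
  qed auto
  have ex: "\<exists>y\<in>W. y \<noteq> x" for x
  proof (rule ccontr)
    assume "\<not> (\<exists>y\<in>W. y \<noteq> x)"
    then have "W \<subseteq> {x}" by auto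
    then have "card W \<le> 1" using card_mono[of "{x}" W] by auto
    then show False using cW d by auto
  qed
  have "z \<in> \<Union>\<F>" if "z \<in> W" for z using ex[of z] that by (auto simp: \<F>_def)
  moreover have "\<Union>\<F> \<subseteq> W" by (auto simp: \<F>_def)
  ultimately have un: "\<Union>\<F> = W" by blast
  have "\<exists>j. G \<subseteq> set (take (d + 1) (drop j w))" if "G \<in> \<F>" for G
    using that w(2) by (intro exI[of _ 0]) (auto simp: \<F>_def W_def)
  moreover have "\<exists>G\<in>\<F>. G \<noteq> W - {l}"
  proof -
    obtain y where "y \<in> W" "y \<noteq> l" using ex[of l] by blast
    then show ?thesis by (intro bexI[of _ "W - {y}"]) (auto simp: \<F>_def)
  qed
  moreover have "(G, H) \<in> (facet_adj d \<F>)\<^sup>*" if "G \<in> \<F>" "H \<in> \<F>" for G H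
    using adj that by (auto simp: \<F>_def)
  moreover have "W - {l} \<in> \<F>" using F by (auto simp: \<F>_def)
  ultimately show ?thesis
    using fs un w(2) unfolding stacked_sphere_def W_def[symmetric] \<F>_def[symmetric] F by simp
qed

text \<open>New facets get level \<open>length w + 1\<close>. They meet surviving old facets only in
  ridges of \<open>F\<close>, where the old level is at least \<open>length w - 1\<close>; hence
  jumps of at most two. To restore this bound at the next stacking facet, note that its ridges
  through u lie in new facets only. Its remaining ridge \<open>F - {l}\<close> does not omit the
  head of w, so there the old level is at least \<open>length w\<close>. This is why the invariant
  treats the head separately.\<close>

lemma stacked_sphere_step:
  assumes d: "d \<ge> 3" and len: "length w \<ge> d + 1" and good: "good d (u # w)"
    and ss: "stacked_sphere d w \<F> lev"
  shows "\<exists>\<F>' lev'. stacked_sphere d (u # w) \<F>' lev'"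
proof -
  define F where "F = set (take d w)"
  have fs: "facet_system d \<F>" and conn: "\<And>G H. G \<in> \<F> \<Longrightarrow> H \<in> \<F> \<Longrightarrow> (G, H) \<in> (facet_adj d \<F>)\<^sup>*"
    and un: "\<Union>\<F> = set w" and F: "F \<in> \<F>"
    and win: "\<And>G. G \<in> \<F> \<Longrightarrow> \<exists>j. G \<subseteq> set (take (d + 1) (drop j w))"
    and levle: "\<And>G. G \<in> \<F> \<Longrightarrow> lev G \<le> length w"
    and levF: "lev F = length w"
    and lip: "\<And>G H. (G, H) \<in> facet_adj d \<F> \<Longrightarrow> lev G \<le> lev H + 2"
    and nb1: "\<And>G x. G \<in> \<F> \<Longrightarrow> x \<in> F \<Longrightarrow> F - {x} \<subseteq> G \<Longrightarrow> length w \<le> lev G + 1"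
    and nb2: "\<And>G x. G \<in> \<F> \<Longrightarrow> x \<in> F \<Longrightarrow> F - {x} \<subseteq> G \<Longrightarrow> x \<noteq> hd w \<Longrightarrow> length w \<le> lev G"
    and bas: "\<exists>G\<in>\<F>. G \<noteq> F \<and> lev G = d + 1"
    using ss unfolding stacked_sphere_def F_def[symmetric] by auto
  have finF: "finite F" "card F = d" using fs F by (auto simp: facet_system_def)
  have u: "u \<notin> set (take (2 * d + 1) w)" using good by auto
  have uF: "u \<notin> F" using u set_take_subset_set_take[of d "2*d+1" w] by (auto simp: F_def)
  have fresh: "\<not> insert u S \<subseteq> G" if S: "S \<subseteq> F" "card S = d - 2" "G \<in> \<F>" for S G
  proof
    assume sub: "insert u S \<subseteq> G"
    obtain j where j: "G \<subseteq> set (take (d + 1) (drop j w))" using win[OF S(3)] by blast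
    show False
    proof (cases "j \<ge> d")
      case True
      then have "\<not> insert u S \<subseteq> set (take (d + 1) (drop j w))"
        using good S(1,2) unfolding F_def good.simps by blast
      then show False using sub j by blast
    next
      case False
      have "take (d + 1) (drop j w) = drop j (take (d + 1 + j) w)" by (simp add: drop_take)
      then have "G \<subseteq> set (take (d + 1 + j) w)" using j set_drop_subset by fastforce
      also have "\<dots> \<subseteq> set (take (2 * d + 1) w)" using False by (intro set_take_subset_set_take) auto
      finally show False using sub u by auto
    qed
  qed
  note st = d fs F uF fresh
  define \<F>' where "\<F>' = stack u F \<F>"
  define lev' where "lev' G = (if G \<in> \<F> then lev G else length w + 1)" for G
  \<comment> \<open>The oldest vertex of \<open>F\<close>, which leaves the window when u
    enters.\<close>
  define l where "l = w ! (d - 1)"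
  have td: "take d w = take (d - 1) w @ [l]"
    using take_Suc_conv_app_nth[of "d - 1" w] len d by (simp add: l_def)
  have dist: "distinct (take d w)" using good_take_distinct[of d w d] good by auto
  have F': "set (take d (u # w)) = insert u (F - {l})" "l \<in> F"
  proof -
    have "take d (u # w) = u # take (d - 1) w" using d by (cases d) auto
    moreover have "F - {l} = set (take (d - 1) w)" using td dist by (auto simp: F_def)
    ultimately show "set (take d (u # w)) = insert u (F - {l})" by simp
    show "l \<in> F" using td by (simp add: F_def)
  qed
  have lhd: "l \<noteq> hd w"
  proof -
    have "w \<noteq> []" using len by auto
    then have "hd w = take d w ! 0" "l = take d w ! (d - 1)" using d len by (auto simp: l_def hd_conv_nth)
    then show ?thesis using nth_eq_iff_index_eq[OF dist, of 0 "d - 1"] d len by auto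
  qed
  have new_notin: "insert u (F - {x}) \<notin> \<F>" for x
    by (rule stack_new_notin[OF st, of "F - {x}"]) (use finF in \<open>auto simp: card_Diff_singleton_if\<close>)
  have old: "G \<in> \<F> \<and> G \<noteq> F \<or> (\<exists>x\<in>F. G = insert u (F - {x}) \<and> G \<notin> \<F>)" if "G \<in> \<F>'" for G
    using that new_notin by (auto simp: \<F>'_def stack_def)
  \<comment> \<open>By freshness an old facet adjacent to a new one cannot contain u, so the shared
    ridge is \<open>F - {x}\<close>.\<close>
  have adjnew: "length w \<le> lev G + 1"
    if x: "x \<in> F" and G: "G \<in> \<F>" and c: "card (insert u (F - {x}) \<inter> G) = d - 1" for x G
  proof -
    have "u \<notin> G"
    proof
      assume uG: "u \<in> G"
      have eq: "insert u (F - {x}) \<inter> G = insert u ((F - {x}) \<inter> G)" using uG by auto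
      have "card ((F - {x}) \<inter> G) = d - 2" using c uF finF unfolding eq by simp
      then show False using stack_new_notin[OF st, of "(F - {x}) \<inter> G" G] uG G by auto
    qed
    then have "insert u (F - {x}) \<inter> G = (F - {x}) \<inter> G" by auto
    then have "(F - {x}) \<inter> G = F - {x}" using c finF x by (intro card_subset_eq) auto
    then show ?thesis using nb1[OF G x] by auto
  qed
  have "stacked_sphere d (u # w) \<F>' lev'"
    unfolding stacked_sphere_def F'(1)
  proof (intro conjI ballI allI impI)
    show "facet_system d \<F>'" unfolding \<F>'_def by (rule stack_facet_system[OF st])
    show "(G, H) \<in> (facet_adj d \<F>')\<^sup>*" if "G \<in> \<F>'" "H \<in> \<F>'" for G H
      using stack_connected[OF st conn] that unfolding \<F>'_def by blast
    show "\<Union>\<F>' = set (u # w)" using stack_Union[OF st] un by (simp add: \<F>'_def)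
    show "insert u (F - {l}) \<in> \<F>'" using F' by (auto simp: \<F>'_def stack_def)
    show "lev' (insert u (F - {l})) = length (u # w)" using new_notin by (simp add: lev'_def)
    show "lev' G \<le> length (u # w)" for G using levle[of G] by (auto simp: lev'_def)
    show "\<exists>j. G \<subseteq> set (take (d + 1) (drop j (u # w)))" if "G \<in> \<F>'" for G
      using old[OF that]
    proof (elim disjE bexE conjE)
      assume "G \<in> \<F>"
      then obtain j where "G \<subseteq> set (take (d + 1) (drop j w))" using win by auto
      then show ?thesis by (intro exI[of _ "Suc j"]) auto
    next
      fix x assume "G = insert u (F - {x})"
      then show ?thesis by (intro exI[of _ 0]) (auto simp: F_def)
    qed
    show "lev' G \<le> lev' H + 2" if "(G, H) \<in> facet_adj d \<F>'" for G H
    proof -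
      have GH: "G \<in> \<F>'" "H \<in> \<F>'" "card (G \<inter> H) = d - 1" using that by (auto simp: facet_adj_def)
      show ?thesis
      proof (cases "G \<in> \<F>"; cases "H \<in> \<F>")
        assume "G \<in> \<F>" "H \<in> \<F>"
        then show ?thesis using lip[of G H] GH by (auto simp: lev'_def facet_adj_def)
      next
        assume "G \<in> \<F>" "H \<notin> \<F>"
        then show ?thesis using levle[of G] by (auto simp: lev'_def)
      next
        assume a: "G \<notin> \<F>" "H \<in> \<F>"
        then obtain x where "x \<in> F" "G = insert u (F - {x})" using old[OF GH(1)] by auto
        then show ?thesis using adjnew[of x H] a GH by (auto simp: lev'_def)
      next
        assume "G \<notin> \<F>" "H \<notin> \<F>"
        then show ?thesis by (auto simp: lev'_def)
      qed
    qed
    fix G x assume G: "G \<in> \<F>'" and x: "x \<in> insert u (F - {l})" and sub: "insert u (F - {l}) - {x} \<subseteq> G"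
    show "length (u # w) \<le> lev' G" if "x \<noteq> hd (u # w)"
    proof -
      have xu: "x \<in> F - {l}" "x \<noteq> u" using x that by auto
      have "card (F - {l} - {x}) = d - 2" using xu finF F'(2) d by auto
      then have "G \<notin> \<F>" using stack_new_notin[OF st, of "F - {l} - {x}" G] sub xu by auto
      then show ?thesis by (auto simp: lev'_def)
    qed
    then show "length (u # w) \<le> lev' G + 1"
    proof (cases "x = u")
      case True
      then have "F - {l} \<subseteq> G" using sub uF by auto
      then show ?thesis using nb2[of G l] F'(2) lhd by (auto simp: lev'_def)
    qed auto
  next
    obtain G where "G \<in> \<F>" "G \<noteq> F" "lev G = d + 1" using bas by auto
    then show "\<exists>G\<in>\<F>'. G \<noteq> insert u (F - {l}) \<and> lev' G = d + 1"
      using new_notin[of l] by (intro bexI[of _ G]) (auto simp: \<F>'_def stack_def lev'_def)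
  qed
  then show ?thesis by blast
qed

lemma stacked_sphere_exists:
  assumes d: "d \<ge> 3" and "length w \<ge> d + 1" "good d w"
  shows "\<exists>\<F> lev. stacked_sphere d w \<F> lev"
  using assms(2,3)
proof (induction w)
  case (Cons u w)
  show ?case
  proof (cases "length w \<ge> d + 1")
    case True
    then show ?thesis using Cons stacked_sphere_step[OF d True Cons.prems(2)] by auto
  next
    case False
    then have "length (u # w) = d + 1" using Cons by auto
    moreover from this have "distinct (u # w)"
      using good_take_distinct[OF Cons.prems(2), of "d + 1"] by simp
    ultimately show ?thesis using stacked_sphere_base[OF d] by blast
  qed
qed auto

text \<open>Along an edge the level falls by at most two, while it has to fall from
  \<open>length w\<close> at the newest facet to d + 1 at some other facet.\<close>

lemma stacked_sphere_diameter:
  fixes w :: "'a list"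
  assumes d: "d \<ge> 3" and ss: "stacked_sphere d w \<F> lev"
  defines "K \<equiv> \<Union>(Pow ` \<F>)"
  shows "pseudomanifold (int d - 1) K" "strongly_connected_complex K" "vertices K = set w"
    "length w \<le> d + 1 + 2 * comb_diameter K"
proof -
  define F where "F = set (take d w)"
  have fs: "facet_system d \<F>" and conn: "\<And>G H. G \<in> \<F> \<Longrightarrow> H \<in> \<F> \<Longrightarrow> (G, H) \<in> (facet_adj d \<F>)\<^sup>*"
    and un: "\<Union>\<F> = set w" and F: "F \<in> \<F>" "lev F = length w"
    and step: "\<And>A B. (A, B) \<in> facet_adj d \<F> \<Longrightarrow> lev A \<le> lev B + 2"
    and "\<exists>G\<in>\<F>. G \<noteq> F \<and> lev G = d + 1"
    using ss unfolding stacked_sphere_def F_def[symmetric] by auto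
  then obtain G where G: "G \<in> \<F>" "lev G = d + 1" by blast
  have d1: "d \<ge> 1" using d by auto
  note cl = facet_system_closure[OF fs d1, folded K_def]
  show "pseudomanifold (int d - 1) K" by (rule cl)
  show sc: "strongly_connected_complex K"
    using conn unfolding strongly_connected_complex_def cl(2,4) by blast
  show "vertices K = set w" using cl(3) un by simp
  have pow: "lev A \<le> lev B + 2 * k" if "(A, B) \<in> facet_adj d \<F> ^^ k" for A B k
    using that
  proof (induction k arbitrary: B)
    case (Suc k)
    then obtain C where "(A, C) \<in> facet_adj d \<F> ^^ k" "(C, B) \<in> facet_adj d \<F>" by auto
    then show ?case using Suc.IH[of C] step[of C B] by simp
  qed auto
  have "lev F \<le> lev G + 2 * dual_dist K F G"
    using dual_dist_relpow[OF sc, of F G] F G pow[of F G "dual_dist K F G"] by (simp add: cl(2,4))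
  moreover have "dual_dist K F G \<le> comb_diameter K"
    unfolding comb_diameter_def
  proof (rule Max_ge)
    have "{dual_dist K s t | s t. s \<in> facets K \<and> t \<in> facets K} = (\<lambda>(s, t). dual_dist K s t) ` (\<F> \<times> \<F>)"
      by (auto simp: cl(2))
    then show "finite {dual_dist K s t | s t. s \<in> facets K \<and> t \<in> facets K}"
      using fs by (auto simp: facet_system_def)
    show "dual_dist K F G \<in> {dual_dist K s t | s t. s \<in> facets K \<and> t \<in> facets K}"
      using F G by (auto simp: cl(2))
  qed
  ultimately show "length w \<le> d + 1 + 2 * comb_diameter K" using F G by simp
qed

section \<open>Counting admissible sequences\<close>

definition good_lists :: "nat \<Rightarrow> nat \<Rightarrow> nat \<Rightarrow> nat list set" where
  "good_lists d n m = {w. length w = m \<and> set w \<subseteq> {..<n} \<and> good d w}"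

lemma finite_good_lists: "finite (good_lists d n m)"
proof -
  have "finite {w. set w \<subseteq> {..<n} \<and> length w = m}" by (rule finite_lists_length_eq) simp
  then show ?thesis by (rule rev_finite_subset) (auto simp: good_lists_def)
qed

text \<open>A distinct list longer than the size of T has an entry outside T. Deleting it keeps all
  entries from T, and the position and value of that entry recover the list.\<close>

lemma distinct_remove_outside:
  assumes "distinct a" "length a = Suc l" "finite T" "card T \<le> l"
  shows "\<exists>p\<le>l. \<exists>x\<in>set a. \<exists>b. a = take p b @ x # drop p b \<and> length b = l \<and> distinct b \<and>
    set b \<subseteq> set a \<and> set a \<inter> T \<subseteq> set b"
proof -
  have "card (set a) = Suc l" using assms distinct_card by metis
  then have "\<not> set a \<subseteq> T" using assms(3,4) card_mono[of T "set a"] by auto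
  then obtain x where x: "x \<in> set a" "x \<notin> T" by auto
  then obtain ys zs where a: "a = ys @ x # zs" using split_list by metis
  then show ?thesis using assms(1,2) x
    by (intro exI[of _ "length ys"] conjI bexI[of _ x] exI[of _ "ys @ zs"]) auto
qed

text \<open>Two deletions outside T leave an arrangement b of T, a subset of X of size d - 1. A list
  is thus coded by two positions (d + 1 and d choices), two values (n choices each) and b, for which
  there are at most (d + 1)!/2 choices.\<close>

lemma card_near_lists:
  fixes X :: "nat set"
  assumes d: "d \<ge> 2" and X: "finite X" "card X \<le> d + 1"
  shows "2 * card {a. length a = d + 1 \<and> set a \<subseteq> {..<n} \<and> distinct a \<and> (\<exists>T. T \<subseteq> set a \<inter> X \<and> card T = d - 1)}
    \<le> d * (d + 1) * n\<^sup>2 * fact (d + 1)" (is "2 * card ?Z \<le> _")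
proof -
  \<comment> \<open>Padding X to exactly d + 1 elements gives an exact count of the
    arrangements.\<close>
  have "infinite (- X)" using X(1) by (simp add: finite_compl)
  then obtain Y where Y: "finite Y" "card Y = d + 1 - card X" "Y \<subseteq> - X"
    using infinite_arbitrarily_large by metis
  define X' where "X' = X \<union> Y"
  have X': "finite X'" "card X' = d + 1" "X \<subseteq> X'"
    using X Y card_Un_disjoint[of X Y] by (auto simp: X'_def)
  define B where "B = {b. length b = d - 1 \<and> distinct b \<and> set b \<subseteq> X'}"
  have "card B = \<Prod>{card X' - (d - 1) + 1..card X'}"
    unfolding B_def by (rule card_lists_distinct_length_eq) (use X' in auto)
  also have "card X' - (d - 1) + 1 = 3" using X' d by auto
  finally have cB: "card B = \<Prod>{3..d + 1}" using X' by simp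
  have "{1..d + 1} = {1, 2} \<union> {3..d + 1}" using d by auto
  then have "fact (d + 1) = (\<Prod>{1, 2} * \<Prod>{3..d + 1} :: nat)"
    unfolding fact_prod by (simp only: of_nat_id prod.union_disjoint finite.intros finite_atLeastAtMost) (subst prod.union_disjoint, auto)
  then have fB: "2 * card B = fact (d + 1)" using cB by simp
  have finB: "finite B"
  proof (rule card_ge_0_finite)
    show "0 < card B" using fB by (metis fact_gt_zero gr0I mult_0_right less_irrefl)
  qed
  \<comment> \<open>The decoder: first y is reinserted into b at q, then x into the result at
    p.\<close>
  define g where "g = (\<lambda>(p, x, q, y, b :: nat list). let c = take q b @ y # drop q b in take p c @ x # drop p c)"
  define D where "D = {..d} \<times> {..<n} \<times> {..<d} \<times> {..<n} \<times> B"
  have "?Z \<subseteq> g ` D"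
  proof
    fix a assume "a \<in> ?Z"
    then obtain T where a: "length a = d + 1" "set a \<subseteq> {..<n}" "distinct a"
      and T: "T \<subseteq> set a \<inter> X" "card T = d - 1" by blast
    have finT: "finite T" using T X finite_subset[of T X] by auto
    obtain p x c where p: "p \<le> d" "x \<in> set a" "a = take p c @ x # drop p c"
      and c: "length c = d" "distinct c" "set c \<subseteq> set a" "set a \<inter> T \<subseteq> set c"
      using distinct_remove_outside[of a d T] a T finT by auto
    have "length c = Suc (d - 1)" "card T \<le> d - 1" using c T d by auto
    then obtain q y b where q: "q \<le> d - 1" "y \<in> set c" "c = take q b @ y # drop q b"
      and b: "length b = d - 1" "distinct b" "set c \<inter> T \<subseteq> set b"
      using distinct_remove_outside[OF c(2) _ finT] by blast
    have "T \<subseteq> set b" using T c(4) b(3) by blast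
    then have "T = set b" using b(1,2) T(2) distinct_card[of b] by (intro card_subset_eq) auto
    then have "b \<in> B" using b T X' by (auto simp: B_def)
    then have "(p, x, q, y, b) \<in> D" using p(1,2) q(1,2) a(2) c(3) d by (auto simp: D_def)
    moreover have "a = g (p, x, q, y, b)" using p(3) q(3) by (simp add: g_def)
    ultimately show "a \<in> g ` D" by blast
  qed
  moreover have "finite D" using finB by (auto simp: D_def)
  ultimately have "card ?Z \<le> card D" using surj_card_le by blast
  then have "2 * card ?Z \<le> 2 * card D" by simp
  also have "\<dots> = (d + 1) * n * d * n * (2 * card B)" by (simp add: D_def card_cartesian_product algebra_simps)
  also have "\<dots> = d * (d + 1) * n\<^sup>2 * fact (d + 1)" unfolding fB by (simp add: power2_eq_square algebra_simps)
  finally show ?thesis .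
qed

text \<open>A one-element extension of a good list that fails to be good either repeats a recent entry, or
  its last \<open>d + 1\<close> entries contain \<open>d - 1\<close> entries of an old window. In the second case one forgets
  these \<open>d + 1\<close> entries: they are determined by the rest up to few choices.\<close>

lemma good_lists_extend:
  fixes d n m :: nat
  assumes d: "d \<ge> 3"
  defines "c \<equiv> real d * (real d + 1) * (real n)\<^sup>2 * fact (d + 1) / 2"
  shows "real n * card (good_lists d n m) \<le> card (good_lists d n (Suc m))
    + (2 * real d + 1) * card (good_lists d n m) + real (m - d) * c * card (good_lists d n (m - d))"
proof -
  let ?G = "good_lists d n"
  define Z where "Z X = {a. length a = d + 1 \<and> set a \<subseteq> {..<n} \<and> distinct a \<and> (\<exists>T. T \<subseteq> set a \<inter> X \<and> card T = d - 1)}" for X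
  have finZ: "finite (Z X)" for X
    by (rule finite_subset[OF _ finite_lists_length_eq[of "{..<n}" "d + 1"]]) (auto simp: Z_def)
  define win where "win j z = set (take (d + 1) (drop j z))" for j and z :: "nat list"
  have cZ: "real (card (Z (win j z))) \<le> c" for j z
  proof -
    have "card (win j z) \<le> d + 1"
      unfolding win_def using card_length[of "take (d + 1) (drop j z)"] by (auto intro: le_trans)
    then have "2 * card (Z (win j z)) \<le> d * (d + 1) * n\<^sup>2 * fact (d + 1)"
      unfolding Z_def using d by (intro card_near_lists) (auto simp: win_def)
    then have "real (2 * card (Z (win j z))) \<le> real (d * (d + 1) * n\<^sup>2 * fact (d + 1))"
      by (rule of_nat_mono)
    then show ?thesis by (simp add: c_def field_simps)
  qed
  \<comment> \<open>\<open>U\<close> holds all one-entry extensions, \<open>A\<close> those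
    repeating a recent entry, and \<open>B j\<close> covers those clashing with the window at offset
    j. As j is at least d, that window lies in the remainder z after dropping d entries of w, at
    offset j - d.\<close>
  define U where "U = (\<lambda>(w, u). u # w) ` (?G m \<times> {..<n})"
  define A where "A = (\<lambda>(w, u). u # w) ` (SIGMA w:?G m. set (take (2 * d + 1) w))"
  define B where "B j = (\<lambda>(z, a). a @ z) ` (SIGMA z:?G (m - d). Z (win (j - d) z))" for j
  have cU: "card U = n * card (?G m)"
    unfolding U_def by (subst card_image) (auto simp: inj_on_def card_cartesian_product)
  have finA: "finite A" unfolding A_def using finite_good_lists by auto
  have "card A \<le> card (SIGMA w:?G m. set (take (2 * d + 1) w))"
    unfolding A_def by (rule card_image_le) (use finite_good_lists in auto)
  also have "\<dots> = (\<Sum>w\<in>?G m. card (set (take (2 * d + 1) w)))"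
    by (rule card_SigmaI) (use finite_good_lists in auto)
  also have "\<dots> \<le> (\<Sum>w\<in>?G m. 2 * d + 1)"
    by (rule sum_mono) (rule order_trans[OF card_length], simp)
  finally have cA: "card A \<le> (2 * d + 1) * card (?G m)" by (simp add: mult.commute)
  have finB: "finite (B j)" for j unfolding B_def using finite_good_lists finZ by auto
  have cB: "real (card (B j)) \<le> c * card (?G (m - d))" for j
  proof -
    have "card (B j) \<le> card (SIGMA z:?G (m - d). Z (win (j - d) z))"
      unfolding B_def by (rule card_image_le) (use finite_good_lists finZ in auto)
    also have "\<dots> = (\<Sum>z\<in>?G (m - d). card (Z (win (j - d) z)))"
      by (rule card_SigmaI) (use finite_good_lists finZ in auto)
    finally have "real (card (B j)) \<le> (\<Sum>z\<in>?G (m - d). real (card (Z (win (j - d) z))))"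
      by (metis of_nat_mono of_nat_sum)
    also have "\<dots> \<le> (\<Sum>z\<in>?G (m - d). c)" by (rule sum_mono) (rule cZ)
    finally show ?thesis by (simp add: mult.commute)
  qed
  have sub: "U \<subseteq> ?G (Suc m) \<union> A \<union> (\<Union>j\<in>{d..<m}. B j)"
  proof
    fix v assume "v \<in> U"
    then obtain u w where v: "v = u # w" "w \<in> ?G m" "u < n" by (auto simp: U_def)
    have w: "length w = m" "set w \<subseteq> {..<n}" "good d w" using v by (auto simp: good_lists_def)
    show "v \<in> ?G (Suc m) \<union> A \<union> (\<Union>j\<in>{d..<m}. B j)"
    proof (cases "good d (u # w)")
      case True
      then have "v \<in> ?G (Suc m)" unfolding good_lists_def using v w by simp
      then show ?thesis by blast
    next
      case bad: False
      show ?thesis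
      proof (cases "u \<in> set (take (2 * d + 1) w)")
        case True
        then have "v \<in> A" using v unfolding A_def by force
        then show ?thesis by blast
      next
        case False
        then obtain j S where j: "j \<ge> d" and S: "S \<subseteq> set (take d w)" "card S = d - 2"
          "insert u S \<subseteq> set (take (d + 1) (drop j w))"
          using bad w(3) by (auto simp del: insert_subset)
        \<comment> \<open>Beyond the end of w windows are empty, so only m - d offsets can
          clash.\<close>
        have jm: "j < m"
        proof (rule ccontr)
          assume "\<not> j < m"
          then have "drop j w = []" using w by simp
          then show False using S(3) by simp
        qed
        have "distinct (take (2 * d + 2) (u # w))"
          using good_take_distinct[OF w(3), of "2 * d + 1"] False by simp
        then have "distinct (take (d + 1) (take (2 * d + 2) (u # w)))" by (rule distinct_take)
        then have dist: "distinct (u # take d w)" by (simp add: min_def)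
        have fS: "finite S" "u \<notin> S" using S(1) dist finite_subset by auto
        have dd: "drop j w = drop (j - d) (drop d w)" using j by simp
        have "insert u S \<subseteq> set (u # take d w) \<inter> win (j - d) (drop d w)"
          using S unfolding win_def dd by auto
        moreover have "card (insert u S) = d - 1" using fS S(2) d by simp
        moreover have "set (u # take d w) \<subseteq> {..<n}" using w(2) v(3) set_take_subset[of d w] by auto
        moreover have "length (u # take d w) = d + 1" using w jm j by simp
        ultimately have "u # take d w \<in> Z (win (j - d) (drop d w))" using dist unfolding Z_def by blast
        moreover have "drop d w \<in> ?G (m - d)"
          using w good_drop[OF w(3)] set_drop_subset[of d w] by (auto simp: good_lists_def)
        moreover have "v = (u # take d w) @ drop d w" using v by simp
        ultimately have "v \<in> B j" unfolding B_def by (intro image_eqI[of _ _ "(drop d w, u # take d w)"]) auto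
        then show ?thesis using j jm by auto
      qed
    qed
  qed
  have "card U \<le> card (?G (Suc m) \<union> A \<union> (\<Union>j\<in>{d..<m}. B j))"
    using sub finA finB finite_good_lists by (intro card_mono) auto
  also have "\<dots> \<le> card (?G (Suc m)) + card A + card (\<Union>j\<in>{d..<m}. B j)"
    by (meson card_Un_le add_le_mono1 le_trans)
  also have "\<dots> \<le> card (?G (Suc m)) + card A + (\<Sum>j\<in>{d..<m}. card (B j))"
    by (intro add_left_mono card_UN_le) auto
  finally have "real (card U) \<le> real (card (?G (Suc m)) + card A + (\<Sum>j\<in>{d..<m}. card (B j)))"
    by (rule of_nat_mono)
  then have "real (card U) \<le> card (?G (Suc m)) + real (card A) + (\<Sum>j\<in>{d..<m}. real (card (B j)))" by simp
  moreover have "(\<Sum>j\<in>{d..<m}. real (card (B j))) \<le> (\<Sum>j\<in>{d..<m}. c * card (?G (m - d)))"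
    by (rule sum_mono) (rule cB)
  moreover have "real (card A) \<le> (2 * real d + 1) * card (?G m)"
    using of_nat_mono[OF cA, where 'a = real] by (simp add: algebra_simps)
  ultimately show ?thesis using cU by (simp add: mult.assoc)
qed

text \<open>The error term in \<open>good_lists_extend\<close> refers to length m - d. Applying the
  induction hypothesis d times bounds that count by the one for m divided by
  \<open>\<beta> ^ d\<close>, so the loss becomes a multiple of the current count, and
  \<open>le\<close> leaves room for it.\<close>

lemma good_lists_growth:
  fixes d n M :: nat and \<beta> :: real
  assumes d: "d \<ge> 3" and \<beta>: "\<beta> > 0"
    and le: "\<beta> + (2 * real d + 1) +
      real M * (real d * (real d + 1) * (real n)\<^sup>2 * fact (d + 1) / 2) / \<beta> ^ d \<le> real n"
  shows "m < M \<Longrightarrow> \<beta> * card (good_lists d n m) \<le> card (good_lists d n (Suc m))"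
proof (induction m rule: less_induct)
  case (less m)
  define c where "c = real d * (real d + 1) * (real n)\<^sup>2 * fact (d + 1) / 2"
  define G where "G k = real (card (good_lists d n k))" for k
  have c0: "c \<ge> 0" by (auto simp: c_def)
  have ext: "real n * G m \<le> G (Suc m) + (2 * real d + 1) * G m + real (m - d) * c * G (m - d)"
    using good_lists_extend[OF d, of n m] unfolding G_def c_def .
  have "real (m - d) * c * G (m - d) \<le> real M * c / \<beta> ^ d * G m"
  proof (cases "m \<ge> d")
    \<comment> \<open>Here the truncated difference m - d is 0 and the error term vanishes.\<close>
    case False
    then show ?thesis using c0 \<beta> by (simp add: G_def)
  next
    case True
    have "\<beta> ^ k * G (m - d) \<le> G (m - d + k)" if "k \<le> d" for k
      using that
    proof (induction k)
      case (Suc k)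
      have "\<beta> * (\<beta> ^ k * G (m - d)) \<le> \<beta> * G (m - d + k)" using Suc \<beta> by (intro mult_left_mono) auto
      also have "\<dots> \<le> G (Suc (m - d + k))"
        unfolding G_def by (rule less.IH) (use Suc less.prems True in auto)
      finally show ?case by (simp add: mult.assoc)
    qed simp
    from this[of d] have "\<beta> ^ d * G (m - d) \<le> G m" using True by simp
    then have "G (m - d) \<le> G m / \<beta> ^ d" using \<beta> by (simp add: field_simps)
    then have "real (m - d) * c * G (m - d) \<le> real M * c * (G m / \<beta> ^ d)"
      using c0 less.prems by (intro mult_mono) (auto simp: G_def)
    then show ?thesis by simp
  qed
  then have "real n * G m \<le> G (Suc m) + ((2 * real d + 1) + real M * c / \<beta> ^ d) * G m"
    using ext by (simp add: algebra_simps)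
  moreover have "(\<beta> + (2 * real d + 1) + real M * c / \<beta> ^ d) * G m \<le> real n * G m"
    using le unfolding c_def by (intro mult_right_mono) (auto simp: G_def)
  ultimately show ?case unfolding G_def by (simp add: algebra_simps)
qed

section \<open>Long good lists and the bounds on \<open>H_pm\<close> for fixed n\<close>

lemma good_lists_nonempty:
  fixes d n M :: nat and \<beta> :: real
  assumes d: "d \<ge> 3" and \<beta>: "\<beta> > 0"
    and le: "\<beta> + (2 * real d + 1) +
      real M * (real d * (real d + 1) * (real n)\<^sup>2 * fact (d + 1) / 2) / \<beta> ^ d \<le> real n"
  shows "good_lists d n M \<noteq> {}"
proof -
  have "m \<le> M \<Longrightarrow> 0 < card (good_lists d n m)" for m
  proof (induction m)
    case 0
    have "good_lists d n 0 = {[]}" by (auto simp: good_lists_def)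
    then show ?case by simp
  next
    case (Suc m)
    then have "0 < \<beta> * card (good_lists d n m)" using \<beta> by simp
    also have "\<dots> \<le> card (good_lists d n (Suc m))"
      by (rule good_lists_growth[OF d \<beta> le]) (use Suc in auto)
    finally show ?case by simp
  qed
  from this[of M] show ?thesis by auto
qed

lemma pseudomanifold_of_good_list:
  assumes d: "d \<ge> 3" and n: "n > d" and w: "w \<in> good_lists d n m"
  shows "\<exists>K :: nat set set. pseudomanifold (int d - 1) K \<and> strongly_connected_complex K \<and>
    card (vertices K) = n \<and> m \<le> d + 1 + 2 * comb_diameter K"
proof -
  define us where "us = sorted_list_of_set ({..<n} - set w)"
  have us: "distinct us" "set us = {..<n} - set w" by (auto simp: us_def)
  have w: "length w = m" "set w \<subseteq> {..<n}" "good d w" using w by (auto simp: good_lists_def)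
  have good: "good d (us @ w)" using us w by (intro good_append_unused) auto
  have set: "set (us @ w) = {..<n}" using us w by auto
  then have "n \<le> length (us @ w)" using card_length[of "us @ w"] by simp
  then have "length (us @ w) \<ge> d + 1" using n by simp
  then obtain \<F> lev where ss: "stacked_sphere d (us @ w) \<F> lev"
    using stacked_sphere_exists[OF d _ good] by blast
  note K = stacked_sphere_diameter[OF d ss]
  show ?thesis
    using K w(1) set by (intro exI[of _ "\<Union>(Pow ` \<F>)"]) auto
qed

text \<open>The maximum has to be shown meaningful: the upper bound makes the set of diameters
  finite although there are infinitely many labelled complexes, and the empty good list provides a
  member.\<close>

lemma H_pm_bounds:
  assumes d: "d \<ge> 3" and n: "n > d"
  shows "H_pm n d * (d * (d + 1)) \<le> 6 * (n choose (d - 1))"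
    and "w \<in> good_lists d n m \<Longrightarrow> m \<le> d + 1 + 2 * H_pm n d"
proof -
  define S where "S = {comb_diameter K | K :: nat set set.
     pseudomanifold (int d - 1) K \<and> strongly_connected_complex K \<and> card (vertices K) = n}"
  have H: "H_pm n d = Max S" by (simp add: H_pm_def S_def)
  have up: "s * (d * (d + 1)) \<le> 6 * (n choose (d - 1))" if "s \<in> S" for s
  proof -
    obtain K :: "nat set set" where K: "pseudomanifold (int d - 1) K" "strongly_connected_complex K"
      "card (vertices K) = n" "s = comb_diameter K" using \<open>s \<in> S\<close> by (auto simp: S_def)
    have "finite (vertices K)" using K(3) n by (intro card_ge_0_finite) auto
    then show ?thesis using comb_diameter_upper[OF K(1,2)] K(3,4) d by auto
  qed
  have "s \<le> 6 * (n choose (d - 1))" if "s \<in> S" for s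
  proof -
    have "s * 1 \<le> s * (d * (d + 1))" using d by (intro mult_le_mono2) auto
    then show ?thesis using up[OF that] by linarith
  qed
  then have fin: "finite S" by (meson finite_nat_set_iff_bounded_le)
  have ex: "\<exists>s\<in>S. m \<le> d + 1 + 2 * s" if "w \<in> good_lists d n m" for w m
    using pseudomanifold_of_good_list[OF d n that] unfolding S_def by blast
  have "[] \<in> good_lists d n 0" by (simp add: good_lists_def)
  then have "S \<noteq> {}" using ex by blast
  then show "H_pm n d * (d * (d + 1)) \<le> 6 * (n choose (d - 1))"
    using up Max_in[OF fin] unfolding H by blast
  show "m \<le> d + 1 + 2 * H_pm n d" if "w \<in> good_lists d n m"
    using ex[OF that] Max_ge[OF fin] unfolding H by fastforce
qed

section \<open>Asymptotics\<close>

text \<open>With \<open>\<beta>\<close> = nd/(d + 1) there remains room n/(d + 1). The main error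
  term equals n(d + 1)^2/(4d^3), and the hypothesis \<open>large\<close> says that the difference
  absorbs the terms not growing with n, including the extra d + 2 in the bound on M.\<close>

lemma growth_condition:
  fixes d n M :: nat
  assumes d: "d \<ge> 3" and n: "n \<ge> 1"
    and M: "real M \<le> real n ^ (d - 1) / (2 * exp 1 * real d ^ 4 * fact d) + (real d + 2)"
    and large: "(2 * real d + 1) + (real d + 2) * (real d * (real d + 1) * fact (d + 1) / 2 * exp 1)
      \<le> real n * (1 / (real d + 1) - (real d + 1)\<^sup>2 / (4 * real d ^ 3))"
  shows "real n * real d / (real d + 1) + (2 * real d + 1) +
    real M * (real d * (real d + 1) * (real n)\<^sup>2 * fact (d + 1) / 2) / (real n * real d / (real d + 1)) ^ d
    \<le> real n"
proof -
  define \<beta> where "\<beta> = real n * real d / (real d + 1)"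
  define C where "C = real d * (real d + 1) * fact (d + 1) / 2"
  define x where "x = real n ^ (d - 1) / (2 * exp 1 * real d ^ 4 * fact d)"
  have C0: "C \<ge> 0" by (simp add: C_def)
  have n0: "real n > 0" and d0: "real d > 0" using n d by auto
  have \<beta>0: "\<beta> > 0" using n0 d0 by (simp add: \<beta>_def)
  \<comment> \<open>The source of Euler's number in the bound: (1 + 1/d)^d is the ratio of n^d to
    \<open>\<beta> ^ d\<close>.\<close>
  have "(1 + 1 / real d) ^ d \<le> exp (1 / real d) ^ d"
    by (intro power_mono exp_ge_add_one_self) auto
  also have "\<dots> = exp 1" using d0 by (simp flip: exp_of_nat_mult)
  finally have e: "(1 + 1 / real d) ^ d \<le> exp 1" .
  have "1 + 1 / real d = (real d + 1) / real d" using d0 by (simp add: add_divide_distrib)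
  moreover have "real d + 1 \<noteq> 0" using d0 by linarith
  ultimately have "real n = \<beta> * (1 + 1 / real d)" using d0 by (simp add: \<beta>_def)
  then have "real n ^ d = \<beta> ^ d * (1 + 1 / real d) ^ d" by (metis power_mult_distrib)
  also have "\<dots> \<le> \<beta> ^ d * exp 1" using e \<beta>0 by (intro mult_left_mono) auto
  finally have inv: "1 / \<beta> ^ d \<le> exp 1 / real n ^ d" using \<beta>0 n0 by (simp add: field_simps)
  have pw: "real n ^ d = real n ^ (d - 2) * (real n)\<^sup>2" "real n ^ (d - 1) = real n ^ (d - 2) * real n"
    using d power_add[of "real n" "d - 2" 2] power_add[of "real n" "d - 2" 1]
    by (simp_all add: Suc_diff_Suc numeral_2_eq_2)
  have "real M * (C * (real n)\<^sup>2) / \<beta> ^ d = real M * (C * (real n)\<^sup>2) * (1 / \<beta> ^ d)" by simp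
  also have "\<dots> \<le> (x + (real d + 2)) * (C * (real n)\<^sup>2) * (exp 1 / real n ^ d)"
    using M inv C0 \<beta>0 by (intro mult_mono) (auto simp: x_def)
  also have "\<dots> = (x + (real d + 2)) * C * exp 1 / real n ^ (d - 2)"
    using n0 by (simp add: pw(1))
  also have "\<dots> = x * C * exp 1 / real n ^ (d - 2) + (real d + 2) * (C * exp 1) / real n ^ (d - 2)"
    by (simp add: field_simps add_divide_distrib)
  also have "x * C * exp 1 / real n ^ (d - 2) = real n * ((real d + 1)\<^sup>2 / (4 * real d ^ 3))"
  proof -
    have x: "x = real n ^ (d - 2) * real n / (2 * exp 1 * real d ^ 4 * fact d)"
      unfolding x_def pw(2) by (rule refl)
    have C: "C = real d * (real d + 1) * ((real d + 1) * fact d) / 2" by (simp add: C_def)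
    show ?thesis unfolding x C using n0 d0
      by (simp add: divide_simps power2_eq_square power3_eq_cube power4_eq_xxxx)
  qed
  also have "(real d + 2) * (C * exp 1) / real n ^ (d - 2) \<le> (real d + 2) * (C * exp 1)"
  proof -
    have "real n ^ (d - 2) \<ge> 1" using n by (intro one_le_power) auto
    then show ?thesis
      using C0 n0 divide_left_mono[of 1 "real n ^ (d - 2)" "(real d + 2) * (C * exp 1)"] by simp
  qed
  finally have main: "real M * (C * (real n)\<^sup>2) / \<beta> ^ d
    \<le> real n * ((real d + 1)\<^sup>2 / (4 * real d ^ 3)) + (real d + 2) * (C * exp 1)" by simp
  have "\<beta> + real n * (1 / (real d + 1)) = real n * (real d + 1) / (real d + 1)"
    by (simp add: \<beta>_def add_divide_distrib distrib_left)
  then have "\<beta> + real n * (1 / (real d + 1)) = real n" using d0 by simp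
  moreover have "(2 * real d + 1) + (real d + 2) * (C * exp 1)
      \<le> real n * (1 / (real d + 1)) - real n * ((real d + 1)\<^sup>2 / (4 * real d ^ 3))"
    using large by (simp only: C_def right_diff_distrib)
  ultimately have "\<beta> + (2 * real d + 1) + real M * (C * (real n)\<^sup>2) / \<beta> ^ d \<le> real n"
    using main by linarith
  then show ?thesis unfolding \<beta>_def C_def by (simp add: mult_ac)
qed

text \<open>This amounts to (d + 1)^3 < 4d^3. For d at least 3, d + 1 is at most 4d/3, and (4/3)^3 =
  64/27 < 4.\<close>

lemma gap_positive:
  assumes "d \<ge> 3"
  shows "1 / (real d + 1) - (real d + 1)\<^sup>2 / (4 * real d ^ 3) > 0"
proof -
  have d: "real d \<ge> 3" using assms by simp
  have "(real d + 1) ^ 3 \<le> (4 / 3 * real d) ^ 3" using d by (intro power_mono) auto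
  also have "\<dots> < 4 * real d ^ 3" using d by (simp add: power_mult_distrib power_divide)
  finally have "(real d + 1)\<^sup>2 * (real d + 1) < 4 * real d ^ 3"
    by (simp add: power2_eq_square power3_eq_cube)
  then have "(real d + 1)\<^sup>2 / (4 * real d ^ 3) < 1 / (real d + 1)"
    using d by (simp add: divide_less_eq less_divide_eq mult.commute)
  then show ?thesis by simp
qed

lemma H_pm_lower_bound_eventually:
  assumes d: "d \<ge> 3"
  shows "\<exists>n0. \<forall>n\<ge>n0. real n ^ (d - 1) / (4 * exp 1 * real d ^ 4 * fact d) \<le> real (H_pm n d)"
proof -
  define \<gamma> where "\<gamma> = 1 / (real d + 1) - (real d + 1)\<^sup>2 / (4 * real d ^ 3)"
  define A where "A = (2 * real d + 1) + (real d + 2) * (real d * (real d + 1) * fact (d + 1) / 2 * exp 1)"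
  have \<gamma>: "\<gamma> > 0" using gap_positive[OF d] by (simp add: \<gamma>_def)
  show ?thesis
  \<comment> \<open>Beyond A/\<gamma> the linear gap outweighs the constant terms; the added d + 1
    ensures n > d.\<close>
  proof (intro exI[of _ "nat \<lceil>A / \<gamma>\<rceil> + d + 1"] allI impI)
    fix n assume n: "n \<ge> nat \<lceil>A / \<gamma>\<rceil> + d + 1"
    define x where "x = real n ^ (d - 1) / (2 * exp 1 * real d ^ 4 * fact d)"
    \<comment> \<open>The summand d + 1 offsets the loss in
      \<open>M \<le> d + 1 + 2 * H_pm n d\<close>, leaving x at most twice \<open>H_pm n d\<close>;
      this factor turns 2e into 4e.\<close>
    define M where "M = nat \<lceil>x\<rceil> + d + 1"
    have x0: "x \<ge> 0" by (simp add: x_def)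
    have "A / \<gamma> \<le> real n" using n by linarith
    then have large: "A \<le> real n * \<gamma>" using \<gamma> by (simp add: divide_le_eq)
    have M: "real M \<le> x + (real d + 2)" "x + real d + 1 \<le> real M" using x0 by (auto simp: M_def; linarith)+
    have "good_lists d n M \<noteq> {}"
    proof (rule good_lists_nonempty[OF d])
      show "real n * real d / (real d + 1) > 0" using d n by simp
      show "real n * real d / (real d + 1) + (2 * real d + 1) +
        real M * (real d * (real d + 1) * (real n)\<^sup>2 * fact (d + 1) / 2) / (real n * real d / (real d + 1)) ^ d
        \<le> real n"
        using growth_condition[OF d, of n M] n M(1) large unfolding x_def A_def \<gamma>_def by simp
    qed
    then obtain w where "w \<in> good_lists d n M" by blast
    then have "M \<le> d + 1 + 2 * H_pm n d" using H_pm_bounds(2)[OF d] n by simp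
    then have "x \<le> 2 * real (H_pm n d)" using M(2) by linarith
    then show "real n ^ (d - 1) / (4 * exp 1 * real d ^ 4 * fact d) \<le> real (H_pm n d)"
      by (simp add: x_def)
  qed
qed

text \<open>The factor (d - 1)! completes d to d! on the left and turns the binomial coefficient
  into a falling factorial, at most n^(d - 1).\<close>

lemma H_pm_upper_bound:
  assumes d: "d \<ge> 3" and n: "n > d"
  shows "real (H_pm n d) * fact d / real n ^ (d - 1) \<le> 6 / (real d + 1)"
proof -
  have "H_pm n d * (d * (d + 1)) * fact (d - 1) \<le> 6 * ((n choose (d - 1)) * fact (d - 1))"
    using mult_le_mono1[OF H_pm_bounds(1)[OF d n], of "fact (d - 1)"] by (simp add: mult.assoc)
  also have "\<dots> \<le> 6 * n ^ (d - 1)" using binomial_fact_pow[of n "d - 1"] by simp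
  also have "H_pm n d * (d * (d + 1)) * fact (d - 1) = H_pm n d * fact d * (d + 1)"
    using fact_reduce[of d, where 'a = nat] d by (simp add: algebra_simps)
  finally have "real (H_pm n d * fact d * (d + 1)) \<le> real (6 * n ^ (d - 1))" by (rule of_nat_mono)
  then have "real (H_pm n d) * fact d * (real d + 1) \<le> 6 * real n ^ (d - 1)" by (simp add: algebra_simps)
  then show ?thesis using n by (simp add: divide_le_eq le_divide_eq)
qed

theorem theorem3:
  fixes d :: nat
  assumes "d \<ge> 3"
  shows "\<exists>\<epsilon> :: nat \<Rightarrow> real. \<epsilon> \<longlonglongrightarrow> 0 \<and>
    (\<forall>n>d. (1 - \<epsilon> n) * (1 / (4 * exp 1 * real d ^ 4))
               \<le> real (H_pm n d) * fact d / real n ^ (d - 1)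
           \<and> real (H_pm n d) * fact d / real n ^ (d - 1) \<le> 6 / (real d + 1))"
proof -
  obtain n0 where n0: "\<And>n. n \<ge> n0 \<Longrightarrow>
      real n ^ (d - 1) / (4 * exp 1 * real d ^ 4 * fact d) \<le> real (H_pm n d)"
    using H_pm_lower_bound_eventually[OF assms] by blast
  \<comment> \<open>From n0 on the lower bound holds without any loss. Before that, the value 1
    reduces it to nonnegativity.\<close>
  define \<epsilon> :: "nat \<Rightarrow> real" where "\<epsilon> n = (if n \<ge> n0 then 0 else 1)" for n
  have "\<forall>\<^sub>F n in sequentially. \<epsilon> n = 0"
    unfolding \<epsilon>_def eventually_sequentially by (intro exI[of _ n0]) auto
  then have "\<epsilon> \<longlonglongrightarrow> 0" by (rule tendsto_eventually)
  moreover have "(1 - \<epsilon> n) * (1 / (4 * exp 1 * real d ^ 4)) \<le> real (H_pm n d) * fact d / real n ^ (d - 1)"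
    if n: "n > d" for n
  proof (cases "n \<ge> n0")
    case True
    have pos: "real n ^ (d - 1) > 0" using n by simp
    have "real n ^ (d - 1) / (4 * exp 1 * real d ^ 4 * fact d) * fact d \<le> real (H_pm n d) * fact d"
      by (rule mult_right_mono[OF n0[OF True]]) simp
    then have "1 / (4 * exp 1 * real d ^ 4) * real n ^ (d - 1) \<le> real (H_pm n d) * fact d" by simp
    then have "1 / (4 * exp 1 * real d ^ 4) \<le> real (H_pm n d) * fact d / real n ^ (d - 1)"
      using pos by (simp only: pos_le_divide_eq)
    then show ?thesis using True by (simp add: \<epsilon>_def)
  next
    case False
    then show ?thesis by (simp add: \<epsilon>_def)
  qed
  ultimately show ?thesis using H_pm_upper_bound[OF assms] by blast
qed

end
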